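(* Let $\Gamma=(V,E)$ be an infinite weighted graph, $x_0\in V$, $r\ge1$ an integer, and let $B(x_0,r)=\{x\in V:d(x_0,x)\le r\}$. Put $l:=\inf_{x\in B(x_0,r)\setminus\{x_0\}}\frac{\mu(x)}{\mu_-(x)}$ and suppose $2\le l<\infty$. Then $$\lambda_1(B(x_0,r))\ge\lambda_1(V_l(r))-\kappa(x_0,r)\quad\text{and}\quad \lambda_{\mathrm{max}}(B(x_0,r))\le\lambda_{\mathrm{max}}(V_l(r))+\kappa(x_0,r),$$ where $V_l(r)$ is the ball of radius $r$ centered at $0$ in the weighted half-line $R_l$ and $\kappa(x_0,r):=\sup_{x\in B(x_0,r)}\frac{\mu_0(x)}{\mu(x)}$.
   Context: $\Gamma=(V,E)$ is a locally finite, connected graph with infinitely many vertices, equipped with symmetric edge weights $\mu_{xy}=\mu_{yx}\ge 0$, where $\mu_{xy}>0$ iff $(x,y)\in E$ (written $x\sim y$); self-loops ($\mu_{xx}>0$) are allowed. Put $\mu(x)=\sum_{y\in V}\mu_{xy}$, and let $d$ be the graph distance. With respect to the fixed reference vertex $x_0$, $\mu_-(x)=\sum\mu_{xy}$ over $y\sim x$ with $d(x_0,y)=d(x_0,x)-1$, and $\mu_0(x)=\sum\mu_{xy}$ over $y\sim x$ with $d(x_0,y)=d(x_0,x)$ (including $y=x$ if there is a self-loop at $x$). For a finite subset $\Omega$ of a weighted graph, the Dirichlet Laplace operator acts on real functions on $\Omega$ by $\Delta_\Omega f(x)=f(x)-\frac{1}{\mu(x)}\sum_{y\in\Omega}\mu_{xy}f(y)$,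 $x\in\Omega$ (with $\mu(x)$ the degree in the whole graph); $\lambda_1(\Omega)$ and $\lambda_{\mathrm{max}}(\Omega)$ are its smallest and largest eigenvalues. For real $l\ge2$, the weighted half-line $R_l$ has vertex set $\{0,1,2,\dots\}$, edges $(i,i+1)$, $i\ge0$, with weights $\mu_{i,i+1}=(l-1)^i$; $V_l(r)=\{0,1,\dots,r\}$. *)

theory Defs
  imports "HOL-Analysis.Analysis"
begin

section \<open>Weighted graphs\<close>

record 'a wgraph =
  verts :: "'a set"
  edges :: "('a \<times> 'a) set"
  weight :: "'a \<Rightarrow> 'a \<Rightarrow> real"

text \<open>Locally finite, connected weighted graphs. Self-loops are allowed; an undirected edge
  is represented by both of its orientations.\<close>

locale weighted_graph =
  fixes G :: "'a wgraph"
  assumes edges_subset: "edges G \<subseteq> verts G \<times> verts G"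
    and weight_sym: "\<And>x y. x \<in> verts G \<Longrightarrow> y \<in> verts G \<Longrightarrow> weight G x y = weight G y x"
    and weight_nonneg: "\<And>x y. x \<in> verts G \<Longrightarrow> y \<in> verts G \<Longrightarrow> 0 \<le> weight G x y"
    and weight_pos_iff:
      "\<And>x y. x \<in> verts G \<Longrightarrow> y \<in> verts G \<Longrightarrow> 0 < weight G x y \<longleftrightarrow> (x, y) \<in> edges G"
    and locally_finite: "\<And>x. x \<in> verts G \<Longrightarrow> finite {y. (x, y) \<in> edges G}"
    and connected: "\<And>x y. x \<in> verts G \<Longrightarrow> y \<in> verts G \<Longrightarrow> (x, y) \<in> (edges G)\<^sup>*"

text \<open>The degree of \<open>x\<close> is the sum of \<open>weight G x y\<close> over all vertices \<open>y\<close>. It is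
  written as a finite sum over the neighbours, which carry all nonzero weights, because
  \<^const>\<open>sum\<close> is \<open>0\<close> on infinite sets; see \<open>wdegree_eq_infsum\<close>.\<close>

definition wdegree :: "'a wgraph \<Rightarrow> 'a \<Rightarrow> real" where
  "wdegree G x = (\<Sum>y | (x, y) \<in> edges G. weight G x y)"

lemma (in weighted_graph) wdegree_eq_infsum:
  assumes "x \<in> verts G"
  shows "wdegree G x = (\<Sum>\<^sub>\<infinity>y\<in>verts G. weight G x y)"
proof -
  have "(\<Sum>\<^sub>\<infinity>y\<in>verts G. weight G x y) = (\<Sum>\<^sub>\<infinity>y\<in>{y. (x, y) \<in> edges G}. weight G x y)"
  proof (rule infsum_cong_neutral)
    fix y assume "y \<in> verts G - {y. (x, y) \<in> edges G}"
    then show "weight G x y = 0"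
      using weight_nonneg[of x y] weight_pos_iff[of x y] assms by auto
  next
    fix y assume "y \<in> {y. (x, y) \<in> edges G} - verts G"
    then show "weight G x y = 0"
      using edges_subset by auto
  qed simp
  also have "\<dots> = wdegree G x"
    unfolding wdegree_def using locally_finite[OF assms] by (rule infsum_finite)
  finally show ?thesis by simp
qed

definition graph_dist :: "'a wgraph \<Rightarrow> 'a \<Rightarrow> 'a \<Rightarrow> nat" where
  "graph_dist G x y = (LEAST n. (x, y) \<in> edges G ^^ n)"

definition graph_ball :: "'a wgraph \<Rightarrow> 'a \<Rightarrow> nat \<Rightarrow> 'a set" where
  "graph_ball G x r = {y \<in> verts G. graph_dist G x y \<le> r}"

text \<open>The quantities \<open>\<mu>\<^sub>-(x)\<close> and \<open>\<mu>\<^sub>0(x)\<close> with respect to the reference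
  vertex \<open>x0\<close>. The successor form avoids truncated subtraction at \<open>x = x0\<close>.\<close>

definition mu_minus :: "'a wgraph \<Rightarrow> 'a \<Rightarrow> 'a \<Rightarrow> real" where
  "mu_minus G x0 x =
    (\<Sum>y | (x, y) \<in> edges G \<and> graph_dist G x0 y + 1 = graph_dist G x0 x. weight G x y)"

definition mu_zero :: "'a wgraph \<Rightarrow> 'a \<Rightarrow> 'a \<Rightarrow> real" where
  "mu_zero G x0 x =
    (\<Sum>y | (x, y) \<in> edges G \<and> graph_dist G x0 y = graph_dist G x0 x. weight G x y)"

definition kappa :: "'a wgraph \<Rightarrow> 'a \<Rightarrow> nat \<Rightarrow> real" where
  "kappa G x0 r = (SUP x\<in>graph_ball G x0 r. mu_zero G x0 x / wdegree G x)"

section \<open>The Dirichlet Laplace operator\<close>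

text \<open>A real function on \<open>\<Omega>\<close> is represented by a function on the whole type of which only
  the values on \<open>\<Omega>\<close> are used.\<close>

definition dirichlet_laplacian ::
    "'a wgraph \<Rightarrow> 'a set \<Rightarrow> ('a \<Rightarrow> real) \<Rightarrow> 'a \<Rightarrow> real" where
  "dirichlet_laplacian G \<Omega> f x = f x - 1 / wdegree G x * (\<Sum>y\<in>\<Omega>. weight G x y * f y)"

definition dirichlet_eigenvalues :: "'a wgraph \<Rightarrow> 'a set \<Rightarrow> real set" where
  "dirichlet_eigenvalues G \<Omega> =
    {c. \<exists>f. (\<exists>x\<in>\<Omega>. f x \<noteq> 0) \<and> (\<forall>x\<in>\<Omega>. dirichlet_laplacian G \<Omega> f x = c * f x)}"

definition lambda_1 :: "'a wgraph \<Rightarrow> 'a set \<Rightarrow> real" where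
  "lambda_1 G \<Omega> = Min (dirichlet_eigenvalues G \<Omega>)"

definition lambda_max :: "'a wgraph \<Rightarrow> 'a set \<Rightarrow> real" where
  "lambda_max G \<Omega> = Max (dirichlet_eigenvalues G \<Omega>)"

section \<open>The weighted half-line\<close>

definition half_line :: "real \<Rightarrow> nat wgraph" where
  "half_line l =
    \<lparr>verts = UNIV,
     edges = {(i, j). j = Suc i \<or> i = Suc j},
     weight = (\<lambda>i j. if j = Suc i \<or> i = Suc j then (l - 1) ^ min i j else 0)\<rparr>"

lemma weighted_graph_half_line:
  assumes "2 \<le> l"
  shows "weighted_graph (half_line l)"
proof
  let ?E = "{(i, j). j = Suc i \<or> i = Suc j}"
  have up: "(0, i) \<in> ?E\<^sup>*" for i
    by (induction i) (auto intro: rtrancl_into_rtrancl)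
  have down: "(i, 0) \<in> ?E\<^sup>*" for i
    by (induction i) (auto intro: converse_rtrancl_into_rtrancl)
  show "(x, y) \<in> (edges (half_line l))\<^sup>*" for x y
    using rtrancl_trans[OF down up] by (simp add: half_line_def)
  show "finite {y. (x, y) \<in> edges (half_line l)}" for x
    by (rule finite_subset[of _ "{..Suc x}"]) (auto simp: half_line_def)
qed (use assms in \<open>auto simp: half_line_def min.commute\<close>)

lemma graph_ball_half_line: "graph_ball (half_line l) 0 r = {0..r}"
proof -
  let ?E = "edges (half_line l)"
  have "(0, i) \<in> ?E ^^ i" for i
    by (induction i) (auto simp: half_line_def)
  moreover have "i \<le> n" if "(0, i) \<in> ?E ^^ n" for i n
    using that by (induction n arbitrary: i) (fastforce simp: half_line_def)+
  ultimately have "graph_dist (half_line l) 0 i = i" for i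
    unfolding graph_dist_def by (intro Least_equality) auto
  then show ?thesis
    by (auto simp: graph_ball_def half_line_def)
qed

end

theory Submission
  imports Defs "Jordan_Normal_Form.Spectral_Radius"
begin

text \<open>
  Write \<open>P f(x) = 1/\<mu>(x) \<Sum>\<^sub>y\<^sub>\<in>\<^sub>B \<mu>\<^sub>x\<^sub>y f(y)\<close>, so that the Dirichlet Laplacian of a finite set \<open>B\<close> is
  \<open>1 - P\<close>. Both inequalities of the theorem follow from a number \<open>\<rho>\<close> such that \<open>1 - \<rho>\<close> and
  \<open>1 + \<rho>\<close> are eigenvalues of the half-line ball \<open>V\<^sub>l(r)\<close>, while the spectrum of \<open>P\<close> on
  \<open>B(x\<^sub>0,r)\<close> lies in \<open>[-(\<rho> + \<kappa>), \<rho> + \<kappa>]\<close>.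

  On the half-line the eigenvalue equation \<open>P f = t f\<close> is a three-term recursion, solved by
  polynomials \<open>p\<^sub>n(t)\<close>, and \<open>1 - t\<close> is a Dirichlet eigenvalue of \<open>V\<^sub>l(r)\<close> when \<open>p\<^sub>r\<^sub>+\<^sub>1(t) = 0\<close>.
  Take for \<open>\<rho>\<close> the largest zero of \<open>p\<^sub>r\<^sub>+\<^sub>1\<close> in \<open>[0, 1]\<close>. The half-line is bipartite, which appears
  here as \<open>p\<^sub>n(-t) = (-1)\<^sup>n p\<^sub>n(t)\<close>, so \<open>-\<rho>\<close> is a zero as well. Moreover \<open>\<phi>(n) = p\<^sub>n(\<rho>)\<close> is positive
  for \<open>n \<le> r\<close> (lemma \<open>radial_poly_ground_state\<close>) and decreasing (lemma
  \<open>radial_poly_decreasing\<close>).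

  Transplant \<open>\<phi>\<close> to the graph as \<open>f(x) = \<phi>(d(x\<^sub>0,x))\<close>. Compared with the half-line, a vertex \<open>x\<close>
  of the ball has at most the fraction \<open>1/l\<close> of its weight directed towards \<open>x\<^sub>0\<close>, where \<open>\<phi>\<close> is
  larger; and the part of the weight staying on the same sphere is at most the fraction \<open>\<kappa>\<close> and
  costs at most \<open>\<kappa> f(x)\<close>. Hence \<open>P f \<le> (\<rho> + \<kappa>) f\<close> (lemma
  \<open>transplanted_supersolution\<close>). A positive function with this property bounds the modulus of
  every eigenvalue of \<open>P\<close> by \<open>\<rho> + \<kappa>\<close> (lemma \<open>positive_supersolution_eigenvalue_bound\<close>).

  As \<open>\<lambda>\<^sub>1\<close> and \<open>\<lambda>\<^sub>m\<^sub>a\<^sub>x\<close> are a minimum and a maximum of a set of real eigenvalues, that set must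
  also be shown to be finite and, for the graph ball, nonempty. Both follow from the spectrum of a
  complex matrix, because \<open>P\<close> is self-adjoint with respect to the measure \<open>\<mu>\<close>.
\<close>

section \<open>Real spectrum of symmetrizable finite operators\<close>

text \<open>Enumerating the finite index set turns the operator into a matrix, to which the spectral
  theory of complex matrices applies.\<close>

lemma complex_eigenvalues_finite_nonempty:
  fixes a :: "'a \<Rightarrow> 'a \<Rightarrow> complex"
  assumes fin: "finite \<Omega>" and ne: "\<Omega> \<noteq> {}"
  defines "S \<equiv> {c. \<exists>g. (\<exists>x\<in>\<Omega>. g x \<noteq> 0) \<and> (\<forall>x\<in>\<Omega>. (\<Sum>y\<in>\<Omega>. a x y * g y) = c * g x)}"
  shows "finite S" and "S \<noteq> {}"
proof -
  define n where "n = card \<Omega>"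
  have n: "n > 0" using fin ne by (simp add: n_def card_gt_0_iff)
  obtain e where e: "bij_betw e {0..<n} \<Omega>"
    using ex_bij_betw_nat_finite[OF fin] unfolding n_def by blast
  define e' where "e' = inv_into {0..<n} e"
  have e_in: "e i \<in> \<Omega>" if "i < n" for i using e that by (auto simp: bij_betw_def)
  have e'_in: "e' x < n" and ee': "e (e' x) = x" if "x \<in> \<Omega>" for x
    using e that unfolding e'_def
    by (auto simp: bij_betw_def f_inv_into_f dest: inv_into_into[of x e "{0..<n}"])
  have e'e: "e' (e i) = i" if "i < n" for i
    using e that unfolding e'_def by (auto simp: bij_betw_def inv_into_f_f)
  define A where "A = Matrix.mat n n (\<lambda>(i, j). a (e i) (e j))"
  have A: "A \<in> carrier_mat n n" by (simp add: A_def)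
  have reindex: "(\<Sum>y\<in>\<Omega>. h y) = (\<Sum>j = 0..<n. h (e j))" for h :: "'a \<Rightarrow> complex"
    by (rule sum.reindex_bij_betw[OF e, symmetric])
  have "S = spectrum A"
  proof (intro equalityI subsetI)
    fix c assume "c \<in> S"
    then obtain g x where x: "x \<in> \<Omega>" "g x \<noteq> 0"
      and g: "\<forall>x\<in>\<Omega>. (\<Sum>y\<in>\<Omega>. a x y * g y) = c * g x" by (auto simp: S_def)
    define v where "v = Matrix.vec n (\<lambda>i. g (e i))"
    have "vec_index v (e' x) \<noteq> 0" using x by (simp add: v_def e'_in ee')
    then have "v \<noteq> 0\<^sub>v n" using e'_in[OF x(1)] by auto
    moreover have "A *\<^sub>v v = c \<cdot>\<^sub>v v"
      using g by (auto simp: A_def v_def scalar_prod_def e_in reindex)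
    ultimately show "c \<in> spectrum A"
      using A by (auto simp: spectrum_def eigenvalue_def eigenvector_def v_def intro!: exI[of _ v])
  next
    fix c assume "c \<in> spectrum A"
    then obtain v where v: "v \<in> carrier_vec n" "v \<noteq> 0\<^sub>v n" "A *\<^sub>v v = c \<cdot>\<^sub>v v"
      using A by (auto simp: spectrum_def eigenvalue_def eigenvector_def)
    define g where "g x = vec_index v (e' x)" for x
    obtain i where i: "i < n" "vec_index v i \<noteq> 0"
      using v(1,2) by (metis carrier_vecD eq_vecI index_zero_vec(1) index_zero_vec(2))
    have "(\<Sum>y\<in>\<Omega>. a x y * g y) = c * g x" if x: "x \<in> \<Omega>" for x
    proof -
      have "(\<Sum>y\<in>\<Omega>. a x y * g y) = vec_index (A *\<^sub>v v) (e' x)"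
        using v(1) e'_in[OF x] by (simp add: reindex A_def scalar_prod_def g_def e'e ee'[OF x])
      also have "\<dots> = c * g x" using v e'_in[OF x] by (simp add: g_def)
      finally show ?thesis .
    qed
    moreover have "g (e i) \<noteq> 0" using i by (simp add: g_def e'e)
    ultimately show "c \<in> S" using e_in[OF i(1)] by (auto simp: S_def intro!: exI[of _ g])
  qed
  then show "finite S" "S \<noteq> {}"
    using card_finite_spectrum(1)[OF A] spectrum_non_empty[OF A n] by auto
qed

text \<open>Testing the eigenvalue equation against the conjugate eigenfunction makes the eigenvalue a
  quotient of two real numbers: the quadratic form is real by symmetry of \<open>w\<close>.\<close>

lemma symmetric_eigenvalue_real:
  fixes w :: "'a \<Rightarrow> 'a \<Rightarrow> real" and m :: "'a \<Rightarrow> real" and g :: "'a \<Rightarrow> complex"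
  assumes fin: "finite \<Omega>"
    and sym: "\<And>x y. x \<in> \<Omega> \<Longrightarrow> y \<in> \<Omega> \<Longrightarrow> w x y = w y x"
    and pos: "\<And>x. x \<in> \<Omega> \<Longrightarrow> 0 < m x"
    and nz: "z \<in> \<Omega>" "g z \<noteq> 0"
    and eq: "\<And>x. x \<in> \<Omega> \<Longrightarrow> (\<Sum>y\<in>\<Omega>. of_real (w x y) * g y) = c * of_real (m x) * g x"
  shows "c \<in> \<real>"
proof -
  define S where "S = (\<Sum>x\<in>\<Omega>. \<Sum>y\<in>\<Omega>. of_real (w x y) * cnj (g x) * g y)"
  define N where "N = (\<Sum>x\<in>\<Omega>. m x * (cmod (g x))\<^sup>2)"
  have "cnj S = (\<Sum>x\<in>\<Omega>. \<Sum>y\<in>\<Omega>. of_real (w x y) * cnj (g y) * g x)"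
    by (simp add: S_def mult_ac)
  also have "\<dots> = (\<Sum>y\<in>\<Omega>. \<Sum>x\<in>\<Omega>. of_real (w x y) * cnj (g y) * g x)"
    by (rule sum.swap)
  also have "\<dots> = S" unfolding S_def by (intro sum.cong refl) (simp add: sym)
  finally have S: "S \<in> \<real>" by (simp add: Reals_cnj_iff)
  have "S = (\<Sum>x\<in>\<Omega>. cnj (g x) * (\<Sum>y\<in>\<Omega>. of_real (w x y) * g y))"
    by (simp add: S_def sum_distrib_left mult_ac)
  also have "\<dots> = (\<Sum>x\<in>\<Omega>. c * of_real (m x * (cmod (g x))\<^sup>2))"
    by (intro sum.cong refl) (simp only: eq, simp only: of_real_mult complex_norm_square mult_ac)
  also have "\<dots> = c * of_real N" by (simp add: N_def sum_distrib_left)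
  finally have SN: "S = c * of_real N" .
  have "0 < N" unfolding N_def
    using nz pos by (intro sum_pos2[OF fin nz(1)]) (auto simp: less_imp_le)
  then have "c = S / of_real N" using SN by simp
  then show ?thesis using S by simp
qed

lemma dirichlet_eigen_equation:
  assumes "wdegree G x \<noteq> 0"
  shows "dirichlet_laplacian G \<Omega> f x = c * f x \<longleftrightarrow>
    (\<Sum>y\<in>\<Omega>. weight G x y * f y) = (1 - c) * wdegree G x * f x"
  using assms by (auto simp: dirichlet_laplacian_def field_simps)

lemma dirichlet_eigenvalues_finite_nonempty:
  fixes G :: "'a wgraph"
  assumes fin: "finite \<Omega>" and ne: "\<Omega> \<noteq> {}"
    and sym: "\<And>x y. x \<in> \<Omega> \<Longrightarrow> y \<in> \<Omega> \<Longrightarrow> weight G x y = weight G y x"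
    and pos: "\<And>x. x \<in> \<Omega> \<Longrightarrow> 0 < wdegree G x"
  shows "finite (dirichlet_eigenvalues G \<Omega>)" and "dirichlet_eigenvalues G \<Omega> \<noteq> {}"
proof -
  define a where "a x y = complex_of_real (weight G x y / wdegree G x)" for x y
  define S where
    "S = {c. \<exists>g. (\<exists>x\<in>\<Omega>. g x \<noteq> 0) \<and> (\<forall>x\<in>\<Omega>. (\<Sum>y\<in>\<Omega>. a x y * g y) = c * g x)}"
  have S: "finite S" "S \<noteq> {}"
    unfolding S_def using complex_eigenvalues_finite_nonempty[OF fin ne, of a] by auto
  have normalize: "(\<Sum>y\<in>\<Omega>. a x y * g y) = c * g x \<longleftrightarrow>
      (\<Sum>y\<in>\<Omega>. of_real (weight G x y) * g y) = c * of_real (wdegree G x) * g x"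
    if "x \<in> \<Omega>" for x c and g :: "'a \<Rightarrow> complex"
  proof -
    have "(\<Sum>y\<in>\<Omega>. a x y * g y) = (\<Sum>y\<in>\<Omega>. of_real (weight G x y) * g y) / of_real (wdegree G x)"
      by (simp add: a_def sum_divide_distrib)
    moreover have "complex_of_real (wdegree G x) \<noteq> 0" using pos[OF that] by simp
    ultimately show ?thesis by (simp only: divide_eq_eq mult_ac not_False_eq_True if_True)
  qed
  have inj: "inj_on (\<lambda>c. complex_of_real (1 - c)) A" for A by (auto simp: inj_on_def)
  have "(\<lambda>c. complex_of_real (1 - c)) ` dirichlet_eigenvalues G \<Omega> \<subseteq> S"
  proof (intro image_subsetI)
    fix c assume "c \<in> dirichlet_eigenvalues G \<Omega>"
    then obtain f x where f: "x \<in> \<Omega>" "f x \<noteq> 0"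
      "\<And>x. x \<in> \<Omega> \<Longrightarrow> dirichlet_laplacian G \<Omega> f x = c * f x"
      by (auto simp: dirichlet_eigenvalues_def)
    have "(\<Sum>y\<in>\<Omega>. a x y * of_real (f y)) = of_real (1 - c) * of_real (f x)" if "x \<in> \<Omega>" for x
    proof -
      have "(\<Sum>y\<in>\<Omega>. weight G x y * f y) = (1 - c) * wdegree G x * f x"
        using f(3)[OF that] pos[OF that] by (simp add: dirichlet_eigen_equation)
      then show ?thesis unfolding normalize[OF that, where g = "\<lambda>y. of_real (f y)"] by (simp only: of_real_mult[symmetric] of_real_sum[symmetric])
    qed
    then show "complex_of_real (1 - c) \<in> S"
      using f(1,2) by (auto simp: S_def intro!: exI[of _ "\<lambda>y. of_real (f y)"])
  qed
  then show "finite (dirichlet_eigenvalues G \<Omega>)"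
    using S(1) inj by (metis finite_imageD finite_subset)
  obtain c z and g :: "'a \<Rightarrow> complex" where z: "z \<in> \<Omega>" "g z \<noteq> 0"
    and g: "\<And>x. x \<in> \<Omega> \<Longrightarrow> (\<Sum>y\<in>\<Omega>. of_real (weight G x y) * g y) = c * of_real (wdegree G x) * g x"
    using S(2) by (auto simp: S_def normalize)
  have "c \<in> \<real>" using symmetric_eigenvalue_real[OF fin sym pos z g] by blast
  then obtain t where t: "c = of_real t" by (auto elim: Reals_cases)
  \<comment> \<open>The real and the imaginary part of \<open>g\<close> both solve the real eigenvalue equation, and one of
    them does not vanish.\<close>
  have re: "(\<Sum>y\<in>\<Omega>. weight G x y * Re (g y)) = t * wdegree G x * Re (g x)" if "x \<in> \<Omega>" for x
    using arg_cong[OF g[OF that], of Re] by (simp add: t)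
  have im: "(\<Sum>y\<in>\<Omega>. weight G x y * Im (g y)) = t * wdegree G x * Im (g x)" if "x \<in> \<Omega>" for x
    using arg_cong[OF g[OF that], of Im] by (simp add: t)
  have lift: "1 - t \<in> dirichlet_eigenvalues G \<Omega>"
    if "f z \<noteq> 0" "\<And>x. x \<in> \<Omega> \<Longrightarrow> (\<Sum>y\<in>\<Omega>. weight G x y * f y) = t * wdegree G x * f x" for f
    using that z(1) pos
    by (auto simp: dirichlet_eigenvalues_def dirichlet_eigen_equation less_imp_neq[symmetric]
        intro!: exI[of _ f])
  show "dirichlet_eigenvalues G \<Omega> \<noteq> {}"
    using z(2) lift[of "\<lambda>y. Re (g y)"] lift[of "\<lambda>y. Im (g y)"] re im
    by (auto simp: complex_eq_iff)
qed

section \<open>Eigenvalue bounds from positive supersolutions\<close>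

text \<open>The argument of Barta and Collatz--Wielandt: evaluate the eigenvalue equation of \<open>g\<close> where
  \<open>\<bar>g\<bar> / f\<close> is largest.\<close>

lemma positive_supersolution_eigenvalue_bound:
  fixes G :: "'a wgraph"
  assumes fin: "finite \<Omega>"
    and nonneg: "\<And>x y. x \<in> \<Omega> \<Longrightarrow> y \<in> \<Omega> \<Longrightarrow> 0 \<le> weight G x y"
    and pos: "\<And>x. x \<in> \<Omega> \<Longrightarrow> 0 < wdegree G x"
    and fpos: "\<And>x. x \<in> \<Omega> \<Longrightarrow> 0 < f x"
    and super: "\<And>x. x \<in> \<Omega> \<Longrightarrow> (\<Sum>y\<in>\<Omega>. weight G x y * f y) \<le> C * wdegree G x * f x"
    and c: "c \<in> dirichlet_eigenvalues G \<Omega>"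
  shows "\<bar>1 - c\<bar> \<le> C"
proof -
  obtain g z where z: "z \<in> \<Omega>" "g z \<noteq> 0"
    and g: "\<And>x. x \<in> \<Omega> \<Longrightarrow> (\<Sum>y\<in>\<Omega>. weight G x y * g y) = (1 - c) * wdegree G x * g x"
    using c pos
    by (auto simp: dirichlet_eigenvalues_def dirichlet_eigen_equation less_imp_neq[symmetric])
  define q where "q x = \<bar>g x\<bar> / f x" for x
  have "Max (q ` \<Omega>) \<in> q ` \<Omega>" using fin z(1) by (intro Max_in) auto
  then obtain x where x: "x \<in> \<Omega>" and "q x = Max (q ` \<Omega>)" by force
  then have max: "q y \<le> q x" if "y \<in> \<Omega>" for y using fin that by simp
  have "0 < q z" using z fpos by (simp add: q_def)
  then have q: "0 < q x" using max[OF z(1)] by linarith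
  have gq: "\<bar>g y\<bar> = q y * f y" if "y \<in> \<Omega>" for y
    using fpos[OF that] by (simp add: q_def)
  have "\<bar>1 - c\<bar> * (wdegree G x * (q x * f x)) = \<bar>\<Sum>y\<in>\<Omega>. weight G x y * g y\<bar>"
    using pos[OF x] by (simp add: g[OF x] abs_mult gq[OF x])
  also have "\<dots> \<le> (\<Sum>y\<in>\<Omega>. \<bar>weight G x y * g y\<bar>)" by (rule sum_abs)
  also have "\<dots> \<le> (\<Sum>y\<in>\<Omega>. q x * (weight G x y * f y))"
  proof (rule sum_mono)
    fix y assume y: "y \<in> \<Omega>"
    have "\<bar>g y\<bar> \<le> q x * f y"
      using gq[OF y] max[OF y] fpos[OF y] by (simp add: mult_right_mono)
    then have "weight G x y * \<bar>g y\<bar> \<le> weight G x y * (q x * f y)"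
      using nonneg[OF x y] by (rule mult_left_mono)
    then show "\<bar>weight G x y * g y\<bar> \<le> q x * (weight G x y * f y)"
      using nonneg[OF x y] by (simp add: abs_mult mult_ac)
  qed
  also have "\<dots> = q x * (\<Sum>y\<in>\<Omega>. weight G x y * f y)" by (simp add: sum_distrib_left)
  also have "\<dots> \<le> q x * (C * wdegree G x * f x)"
    using super[OF x] q by (simp add: mult_left_mono)
  finally have "\<bar>1 - c\<bar> * (wdegree G x * (q x * f x)) \<le> C * (wdegree G x * (q x * f x))"
    by (simp add: mult_ac)
  moreover have "0 < wdegree G x * (q x * f x)" using q pos[OF x] fpos[OF x] by simp
  ultimately show ?thesis using mult_le_cancel_right_pos by blast
qed

section \<open>Radial eigenfunctions of the half-line\<close>

text \<open>The solution of \<open>P f = t f\<close> on the whole half-line normalized by \<open>f(0) = 1\<close>: the vertex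
  \<open>0\<close> has the single neighbour \<open>1\<close>, and a vertex \<open>n > 0\<close> passes the fraction \<open>1/l\<close> of its weight
  to \<open>n - 1\<close> and \<open>(l - 1)/l\<close> to \<open>n + 1\<close>.\<close>

fun radial_poly :: "real \<Rightarrow> nat \<Rightarrow> real \<Rightarrow> real" where
  "radial_poly l 0 t = 1"
| "radial_poly l (Suc 0) t = t"
| "radial_poly l (Suc (Suc n)) t = (l * t * radial_poly l (Suc n) t - radial_poly l n t) / (l - 1)"

lemma radial_poly_recurrence:
  assumes "2 \<le> l"
  shows "radial_poly l n t + (l - 1) * radial_poly l (Suc (Suc n)) t
    = l * t * radial_poly l (Suc n) t"
  using assms by simp

lemma radial_poly_at_1:
  assumes "2 \<le> l"
  shows "radial_poly l n 1 = 1"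
  using assms by (induction l n "1 :: real" rule: radial_poly.induct) auto

lemma radial_poly_uminus: "radial_poly l n (- t) = (- 1) ^ n * radial_poly l n t"
  by (induction l n t rule: radial_poly.induct) (auto simp: algebra_simps diff_divide_distrib)

lemma continuous_on_radial_poly: "continuous_on A (radial_poly l n)"
proof (induction n rule: less_induct)
  case (less n)
  then show ?case
    by (cases "(l, n, 0 :: real)" rule: radial_poly.cases)
      (auto simp: divide_inverse intro!: continuous_intros)
qed

text \<open>Let \<open>\<rho>\<close> be the last point of \<open>[0, 1]\<close> where one of \<open>p\<^sub>1, \<dots>, p\<^sub>r\<^sub>+\<^sub>1\<close> is not positive. All
  are nonnegative there, and \<open>p\<^sub>n(\<rho>) = 0\<close> for some \<open>n \<le> r\<close> would make \<open>p\<^sub>n\<^sub>+\<^sub>1(\<rho>)\<close> negative by the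
  recursion. So only \<open>p\<^sub>r\<^sub>+\<^sub>1\<close> vanishes at \<open>\<rho>\<close>.\<close>

lemma radial_poly_ground_state:
  assumes l: "2 \<le> l"
  obtains \<rho> where "0 \<le> \<rho>" "\<rho> \<le> 1" "radial_poly l (Suc r) \<rho> = 0"
    "\<And>n. n \<le> r \<Longrightarrow> 0 < radial_poly l n \<rho>"
proof -
  let ?p = "radial_poly l"
  define Z where "Z = (\<Union>i\<in>{1..Suc r}. {t\<in>{0..1}. ?p i t \<le> 0})"
  have "closed {t\<in>{0..1}. ?p i t \<le> 0}" for i
    by (intro continuous_closed_preimage_constant continuous_on_closed_Collect_le
        closed_atLeastAtMost continuous_on_radial_poly continuous_on_const)
  then have "compact {t\<in>{0..1}. ?p i t \<le> 0}" for i
    by (auto simp: compact_eq_bounded_closed intro: bounded_subset[of "{0..1}"])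
  then have "compact Z" unfolding Z_def by (intro compact_UN) auto
  moreover have "0 \<in> Z" by (auto simp: Z_def intro!: bexI[of _ 1])
  ultimately obtain \<rho> where \<rho>: "\<rho> \<in> Z" and max: "\<And>t. t \<in> Z \<Longrightarrow> t \<le> \<rho>"
    using compact_attains_sup[of Z] by blast
  have r01: "0 \<le> \<rho>" "\<rho> \<le> 1" using \<rho> by (auto simp: Z_def)
  have nonneg: "0 \<le> ?p i \<rho>" if i: "i \<le> Suc r" for i
  proof (rule ccontr)
    assume neg: "\<not> 0 \<le> ?p i \<rho>"
    then have i0: "1 \<le> i" by (cases i) auto
    obtain t where t: "\<rho> \<le> t" "t \<le> 1" "?p i t = 0"
      using IVT'[of "?p i" \<rho> 0 1] neg r01 radial_poly_at_1[OF l] continuous_on_radial_poly by auto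
    then have "t \<in> Z" using i i0 r01 by (auto simp: Z_def intro!: bexI[of _ i])
    then have "t = \<rho>" using max t by force
    then show False using t neg by simp
  qed
  have pos: "0 < ?p n \<rho>" if "n \<le> r" for n
    using that
  proof (induction n)
    case (Suc k)
    have "?p (Suc k) \<rho> \<noteq> 0"
    proof
      assume zero: "?p (Suc k) \<rho> = 0"
      have "?p (Suc (Suc k)) \<rho> < 0" using zero Suc l by (simp add: divide_neg_pos)
      then show False using nonneg[of "Suc (Suc k)"] Suc.prems by linarith
    qed
    then show ?case using nonneg[of "Suc k"] Suc.prems by force
  qed simp
  obtain i where i: "i \<in> {1..Suc r}" "?p i \<rho> \<le> 0" using \<rho> by (auto simp: Z_def)
  then have "i = Suc r" using pos[of i] by force
  then show ?thesis using that[OF r01 _ pos] nonneg[of "Suc r"] i by force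
qed

text \<open>For \<open>t \<le> 1\<close> the recursion gives
  \<open>p\<^sub>n - p\<^sub>n\<^sub>+\<^sub>1 \<le> (l - 1) (p\<^sub>n\<^sub>+\<^sub>1 - p\<^sub>n\<^sub>+\<^sub>2)\<close>, which passes the monotonicity on.\<close>

lemma radial_poly_decreasing:
  assumes l: "2 \<le> l" and t: "t \<le> 1" and pos: "\<And>n. n \<le> r \<Longrightarrow> 0 < radial_poly l n t"
    and "n \<le> r"
  shows "radial_poly l (Suc n) t \<le> radial_poly l n t"
  using \<open>n \<le> r\<close>
proof (induction n)
  case (Suc n)
  have "l * t * radial_poly l (Suc n) t \<le> l * radial_poly l (Suc n) t"
    using l t pos[OF Suc.prems] by (simp add: mult_left_le)
  then have "(l - 1) * radial_poly l (Suc (Suc n)) t \<le> (l - 1) * radial_poly l (Suc n) t"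
    using Suc.IH Suc.prems radial_poly_recurrence[OF l, of n t] by (simp add: left_diff_distrib)
  then show ?case using l by (simp del: radial_poly.simps)
qed (simp add: t)

lemma wdegree_half_line:
  shows "wdegree (half_line l) 0 = 1"
    and "wdegree (half_line l) (Suc n) = l * (l - 1) ^ n"
proof -
  have "{y. (0, y) \<in> edges (half_line l)} = {1}"
    and S: "{y. (Suc n, y) \<in> edges (half_line l)} = {n, Suc (Suc n)}"
    by (auto simp: half_line_def)
  then show "wdegree (half_line l) 0 = 1" "wdegree (half_line l) (Suc n) = l * (l - 1) ^ n"
    by (simp_all add: wdegree_def) (simp_all add: half_line_def algebra_simps)
qed

lemma half_line_weighted_sum:
  assumes "f (Suc r) = 0"
  shows "(\<Sum>y\<in>{0..r}. weight (half_line l) 0 y * f y) = f 1"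
    and "n < r \<Longrightarrow> (\<Sum>y\<in>{0..r}. weight (half_line l) (Suc n) y * f y)
      = (l - 1) ^ n * (f n + (l - 1) * f (Suc (Suc n)))"
proof -
  have ext: "(\<Sum>y\<in>{0..r}. h y * f y) = (\<Sum>y\<in>{0..Suc r}. h y * f y)" for h :: "nat \<Rightarrow> real"
    using assms by simp
  have "(\<Sum>y\<in>{0..Suc r}. weight (half_line l) 0 y * f y) = (\<Sum>y\<in>{1}. weight (half_line l) 0 y * f y)"
    by (rule sum.mono_neutral_right) (auto simp: half_line_def)
  then show "(\<Sum>y\<in>{0..r}. weight (half_line l) 0 y * f y) = f 1"
    unfolding ext by (simp add: half_line_def)
  assume "n < r"
  then have "(\<Sum>y\<in>{0..Suc r}. weight (half_line l) (Suc n) y * f y)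
      = (\<Sum>y\<in>{n, Suc (Suc n)}. weight (half_line l) (Suc n) y * f y)"
    by (intro sum.mono_neutral_right) (auto simp: half_line_def)
  then show "(\<Sum>y\<in>{0..r}. weight (half_line l) (Suc n) y * f y)
      = (l - 1) ^ n * (f n + (l - 1) * f (Suc (Suc n)))"
    unfolding ext by (simp add: half_line_def algebra_simps)
qed

text \<open>At a zero of \<open>p\<^sub>r\<^sub>+\<^sub>1\<close> the radial solution satisfies the Dirichlet condition outside
  \<open>V\<^sub>l(r)\<close>.\<close>

lemma radial_poly_root_eigenvalue:
  assumes l: "2 \<le> l" and root: "radial_poly l (Suc r) t = 0"
  shows "1 - t \<in> dirichlet_eigenvalues (half_line l) {0..r}"
proof -
  let ?f = "\<lambda>n. radial_poly l n t"
  have "dirichlet_laplacian (half_line l) {0..r} ?f x = (1 - t) * ?f x" if "x \<in> {0..r}" for x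
  proof (cases x)
    case 0
    show ?thesis
      unfolding 0 using half_line_weighted_sum(1)[of ?f, OF root]
      by (subst dirichlet_eigen_equation) (simp_all add: wdegree_half_line)
  next
    case (Suc n)
    have "(\<Sum>y\<in>{0..r}. weight (half_line l) x y * ?f y) = (l - 1) ^ n * (l * t * ?f x)"
      using half_line_weighted_sum(2)[where f = ?f and l = l and n = n, OF root] that
      unfolding Suc radial_poly_recurrence[OF l] by (simp del: radial_poly.simps)
    then show ?thesis
      unfolding Suc using l
      by (subst dirichlet_eigen_equation) (simp_all add: wdegree_half_line del: radial_poly.simps)
  qed
  then show ?thesis
    by (auto simp: dirichlet_eigenvalues_def intro!: exI[of _ ?f] bexI[of _ 0])
qed

section \<open>Distances and degrees in a weighted graph\<close>

context weighted_graph
begin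

lemma weight_edge_pos: "(x, y) \<in> edges G \<Longrightarrow> 0 < weight G x y"
  using edges_subset weight_pos_iff by blast

lemma edges_sym: "(x, y) \<in> edges G \<Longrightarrow> (y, x) \<in> edges G"
  using edges_subset weight_pos_iff weight_sym by (metis SigmaD1 SigmaD2 subsetD)

lemma relpow_graph_dist:
  assumes "x \<in> verts G" "y \<in> verts G"
  shows "(x, y) \<in> edges G ^^ graph_dist G x y"
  using connected[OF assms] unfolding graph_dist_def
  by (metis (mono_tags) LeastI rtrancl_imp_relpow)

lemma graph_dist_le: "(x, y) \<in> edges G ^^ n \<Longrightarrow> graph_dist G x y \<le> n"
  unfolding graph_dist_def by (rule Least_le)

lemma graph_dist_edge:
  assumes "x0 \<in> verts G" "(x, y) \<in> edges G"
  shows "graph_dist G x0 y \<le> Suc (graph_dist G x0 x)"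
  using assms edges_subset relpow_graph_dist[of x0 x]
  by (intro graph_dist_le) (auto intro: relpow_Suc_I)

lemma graph_dist_eq_0:
  assumes "x0 \<in> verts G" "x \<in> verts G"
  shows "graph_dist G x0 x = 0 \<longleftrightarrow> x = x0"
  using relpow_graph_dist[OF assms] graph_dist_le[of x0 x0 0] by auto

lemma finite_graph_ball:
  assumes "x0 \<in> verts G"
  shows "finite (graph_ball G x0 r)"
proof -
  have sphere: "finite {y. (x0, y) \<in> edges G ^^ n} \<and> {y. (x0, y) \<in> edges G ^^ n} \<subseteq> verts G" for n
  proof (induction n)
    case (Suc n)
    have "{y. (x0, y) \<in> edges G ^^ Suc n}
        = (\<Union>x\<in>{x. (x0, x) \<in> edges G ^^ n}. {y. (x, y) \<in> edges G})" by auto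
    then show ?case using Suc locally_finite edges_subset by auto
  qed (use assms in auto)
  have "graph_ball G x0 r \<subseteq> (\<Union>n\<le>r. {y. (x0, y) \<in> edges G ^^ n})"
    using relpow_graph_dist[OF assms] by (auto simp: graph_ball_def)
  then show ?thesis using sphere by (meson finite_UN_I finite_atMost finite_subset)
qed

lemma wdegree_pos:
  assumes "(x, y) \<in> edges G"
  shows "0 < wdegree G x"
  unfolding wdegree_def
  using assms edges_subset weight_edge_pos
  by (intro sum_pos2[OF locally_finite]) (auto intro: less_imp_le)

lemma wdegree_nonneg: "0 \<le> wdegree G x"
  unfolding wdegree_def using weight_edge_pos by (intro sum_nonneg) (auto intro: less_imp_le)

lemma mu_minus_nonneg: "0 \<le> mu_minus G x0 x"
  unfolding mu_minus_def using weight_edge_pos by (intro sum_nonneg) (auto intro: less_imp_le)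

lemma wdegree_pos_infinite:
  assumes "infinite (verts G)" "x \<in> verts G"
  shows "0 < wdegree G x"
proof -
  obtain y where y: "y \<in> verts G" "y \<noteq> x"
    using assms(1) by (metis finite.emptyI finite_insert finite_subset insertI1 subsetI)
  then obtain z where "(x, z) \<in> edges G"
    using connected[OF assms(2) y(1)] by (metis converse_rtranclE)
  then show ?thesis by (rule wdegree_pos)
qed

text \<open>Summing a radial function over the neighbours only involves the three distances
  \<open>d - 1\<close>, \<open>d\<close>, \<open>d + 1\<close>; the outward part of the degree is eliminated, as the three parts add up
  to \<open>\<mu>(x)\<close>. At \<open>d = 0\<close> the truncated \<open>d - 1\<close> does no harm because \<open>\<mu>\<^sub>-(x\<^sub>0) = 0\<close>.\<close>

lemma radial_neighbour_sum:
  fixes \<phi> :: "nat \<Rightarrow> real"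
  assumes x0: "x0 \<in> verts G" and x: "x \<in> verts G"
  defines "d \<equiv> graph_dist G x0 x"
  shows "(\<Sum>y | (x, y) \<in> edges G. weight G x y * \<phi> (graph_dist G x0 y))
    = wdegree G x * \<phi> (Suc d) + mu_minus G x0 x * (\<phi> (d - 1) - \<phi> (Suc d))
      + mu_zero G x0 x * (\<phi> d - \<phi> (Suc d))"
proof -
  let ?N = "{y. (x, y) \<in> edges G}" and ?D = "graph_dist G x0"
  have fin: "finite ?N" using locally_finite x by blast
  have split: "weight G x y * \<phi> (?D y) = weight G x y * \<phi> (Suc d)
      + (if ?D y + 1 = d then weight G x y else 0) * (\<phi> (d - 1) - \<phi> (Suc d))
      + (if ?D y = d then weight G x y else 0) * (\<phi> d - \<phi> (Suc d))" if "y \<in> ?N" for y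
  proof -
    have "?D y \<le> Suc d" "d \<le> Suc (?D y)"
      using that graph_dist_edge[OF x0] edges_sym unfolding d_def by auto
    then consider "?D y + 1 = d" | "?D y = d" | "?D y = Suc d" by linarith
    then show ?thesis by cases (auto simp: algebra_simps)
  qed
  have restrict: "(\<Sum>y\<in>?N. if Q y then weight G x y else 0) = (\<Sum>y | (x, y) \<in> edges G \<and> Q y. weight G x y)"
    for Q using sum.inter_filter[OF fin, of "weight G x" Q] by simp
  show ?thesis
    unfolding wdegree_def mu_minus_def mu_zero_def d_def[symmetric] restrict[symmetric]
      sum_distrib_right sum.distrib[symmetric]
    by (rule sum.cong[OF refl split])
qed

lemma dirichlet_sum_ball:
  fixes \<phi> :: "nat \<Rightarrow> real"
  assumes x0: "x0 \<in> verts G" and x: "x \<in> graph_ball G x0 r" and bd: "\<phi> (Suc r) = 0"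
  shows "(\<Sum>y\<in>graph_ball G x0 r. weight G x y * \<phi> (graph_dist G x0 y))
    = (\<Sum>y | (x, y) \<in> edges G. weight G x y * \<phi> (graph_dist G x0 y))"
proof (rule sum.mono_neutral_cong)
  fix y assume y: "y \<in> graph_ball G x0 r - {y. (x, y) \<in> edges G}"
  then show "weight G x y * \<phi> (graph_dist G x0 y) = 0"
    using x weight_nonneg[of x y] weight_pos_iff[of x y] by (auto simp: graph_ball_def)
next
  fix y assume y: "y \<in> {y. (x, y) \<in> edges G} - graph_ball G x0 r"
  then have "\<not> graph_dist G x0 y \<le> r" using edges_subset by (auto simp: graph_ball_def)
  moreover have "graph_dist G x0 y \<le> Suc r"
    using y x graph_dist_edge[OF x0, of x y] by (auto simp: graph_ball_def)
  ultimately have "graph_dist G x0 y = Suc r" by simp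
  then show "weight G x y * \<phi> (graph_dist G x0 y) = 0" using bd by simp
qed (use finite_graph_ball[OF x0] locally_finite x in \<open>auto simp: graph_ball_def\<close>)

text \<open>Away from the centre, moving the weight fraction \<open>\<mu>\<^sub>-(x)/\<mu>(x)\<close> up to \<open>1/l\<close> only
  increases the average of \<open>\<phi>\<close>, and with \<open>1/l\<close> the average is that of the half-line, namely
  \<open>\<rho> \<phi>(d)\<close>. The weight staying on the sphere is counted as if it went outward and then corrected
  by at most \<open>k \<phi>(d)\<close>.\<close>

lemma transplanted_supersolution:
  assumes x0: "x0 \<in> verts G" and x: "x \<in> graph_ball G x0 r"
    and l: "2 \<le> l" and \<rho>: "\<rho> \<le> 1"
    and root: "radial_poly l (Suc r) \<rho> = 0"
    and pos: "\<And>n. n \<le> r \<Longrightarrow> 0 < radial_poly l n \<rho>"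
    and minus: "x \<noteq> x0 \<Longrightarrow> l * mu_minus G x0 x \<le> wdegree G x"
    and zero: "mu_zero G x0 x \<le> k * wdegree G x"
  shows "(\<Sum>y\<in>graph_ball G x0 r. weight G x y * radial_poly l (graph_dist G x0 y) \<rho>)
    \<le> (\<rho> + k) * wdegree G x * radial_poly l (graph_dist G x0 x) \<rho>"
proof -
  let ?\<phi> = "\<lambda>n. radial_poly l n \<rho>"
  define d where "d = graph_dist G x0 x"
  define m where "m = wdegree G x"
  have d: "d \<le> r" and xv: "x \<in> verts G" using x by (auto simp: d_def graph_ball_def)
  have dec: "?\<phi> (Suc n) \<le> ?\<phi> n" if "n \<le> r" for n
    using radial_poly_decreasing[OF l \<rho> pos that] .
  have next_nonneg: "0 \<le> ?\<phi> (Suc d)"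
    using d root pos[of "Suc d"] by (cases "d = r") (auto simp del: radial_poly.simps)
  have m: "0 \<le> m" by (simp add: m_def wdegree_nonneg)
  have km: "0 \<le> k * m"
  proof -
    have "0 \<le> mu_zero G x0 x" unfolding mu_zero_def
      using weight_edge_pos by (intro sum_nonneg) (auto intro: less_imp_le)
    then show ?thesis using zero by (simp add: m_def)
  qed
  have "mu_zero G x0 x * (?\<phi> d - ?\<phi> (Suc d)) \<le> k * m * (?\<phi> d - ?\<phi> (Suc d))"
    using zero dec[OF d] by (intro mult_right_mono) (auto simp: m_def)
  also have "\<dots> \<le> k * m * ?\<phi> d" using km next_nonneg by (intro mult_left_mono) auto
  finally have sphere: "mu_zero G x0 x * (?\<phi> d - ?\<phi> (Suc d)) \<le> k * m * ?\<phi> d" .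
  have rest: "m * ?\<phi> (Suc d) + mu_minus G x0 x * (?\<phi> (d - 1) - ?\<phi> (Suc d)) \<le> \<rho> * m * ?\<phi> d"
  proof (cases d)
    case 0
    then have "mu_minus G x0 x = 0" by (simp add: mu_minus_def d_def)
    then show ?thesis using 0 by simp
  next
    case (Suc n)
    then have "x \<noteq> x0" using graph_dist_eq_0[OF x0 xv] by (auto simp: d_def)
    then have mm: "l * mu_minus G x0 x \<le> m" using minus by (simp add: m_def)
    have "?\<phi> (Suc (Suc n)) \<le> ?\<phi> n" using dec[of n] dec[of "Suc n"] d Suc by simp
    then have "l * mu_minus G x0 x * (?\<phi> n - ?\<phi> (Suc (Suc n))) \<le> m * (?\<phi> n - ?\<phi> (Suc (Suc n)))"
      using mm by (intro mult_right_mono) auto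
    then have "l * (m * ?\<phi> (Suc (Suc n)) + mu_minus G x0 x * (?\<phi> n - ?\<phi> (Suc (Suc n))))
        \<le> m * (?\<phi> n + (l - 1) * ?\<phi> (Suc (Suc n)))"
      by (simp add: algebra_simps del: radial_poly.simps)
    also have "\<dots> = l * (\<rho> * m * ?\<phi> (Suc n))"
      unfolding radial_poly_recurrence[OF l] by (simp only: mult_ac)
    finally show ?thesis using l Suc by (simp del: radial_poly.simps)
  qed
  show ?thesis
    unfolding dirichlet_sum_ball[OF x0 x, of ?\<phi>, OF root] radial_neighbour_sum[OF x0 xv, of ?\<phi>]
    using sphere rest unfolding d_def[symmetric] m_def[symmetric] by (simp add: algebra_simps)
qed

lemma mu_zero_le_kappa:
  assumes "x0 \<in> verts G" "x \<in> graph_ball G x0 r" "0 < wdegree G x"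
  shows "mu_zero G x0 x \<le> kappa G x0 r * wdegree G x"
proof -
  have "mu_zero G x0 x / wdegree G x \<le> kappa G x0 r"
    unfolding kappa_def using assms finite_graph_ball
    by (intro cSUP_upper bdd_above_finite) auto
  then show ?thesis using assms(3) by (simp add: divide_le_eq)
qed

text \<open>The product form also covers \<open>\<mu>\<^sub>-(x) = 0\<close>, where the quotient has the value \<open>0\<close>.\<close>

lemma INF_mult_mu_minus_le:
  assumes "x \<in> A"
  shows "(INF x\<in>A. wdegree G x / mu_minus G x0 x) * mu_minus G x0 x \<le> wdegree G x"
proof -
  have "bdd_below ((\<lambda>x. wdegree G x / mu_minus G x0 x) ` A)"
    by (intro bdd_belowI2[of _ 0] divide_nonneg_nonneg wdegree_nonneg mu_minus_nonneg)
  then have "(INF x\<in>A. wdegree G x / mu_minus G x0 x) \<le> wdegree G x / mu_minus G x0 x"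
    using assms by (rule cINF_lower)
  then show ?thesis
    using mu_minus_nonneg[of x0 x] wdegree_nonneg[of x]
    by (cases "mu_minus G x0 x = 0") (auto simp: le_divide_eq)
qed

end

section \<open>Comparison of the graph ball with the half-line ball\<close>

theorem theorem5p2:
  fixes G :: "'a wgraph" and x0 :: 'a and r :: nat and l :: real
  assumes "weighted_graph G"
    and "infinite (verts G)"
    and "x0 \<in> verts G"
    and "1 \<le> r"
    and "l = (INF x\<in>graph_ball G x0 r - {x0}. wdegree G x / mu_minus G x0 x)"
    and "2 \<le> l"
  shows "lambda_1 G (graph_ball G x0 r) \<ge>
           lambda_1 (half_line l) (graph_ball (half_line l) 0 r) - kappa G x0 r
       \<and> lambda_max G (graph_ball G x0 r) \<le>
           lambda_max (half_line l) (graph_ball (half_line l) 0 r) + kappa G x0 r"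
proof -
  interpret weighted_graph G by fact
  interpret H: weighted_graph "half_line l" using weighted_graph_half_line assms(6) .
  let ?B = "graph_ball G x0 r" and ?V = "{0..r}"
  let ?EB = "dirichlet_eigenvalues G ?B" and ?EV = "dirichlet_eigenvalues (half_line l) ?V"
  obtain \<rho> where \<rho>: "\<rho> \<le> 1" and root: "radial_poly l (Suc r) \<rho> = 0"
    and pos: "\<And>n. n \<le> r \<Longrightarrow> 0 < radial_poly l n \<rho>"
    using radial_poly_ground_state[OF assms(6)] by metis
  have "0 < wdegree (half_line l) x" for x
    by (rule H.wdegree_pos_infinite) (auto simp: half_line_def)
  then have finV: "finite ?EV"
    by (intro dirichlet_eigenvalues_finite_nonempty) (auto simp: half_line_def min.commute)
  have "1 - \<rho> \<in> ?EV" using assms(6) root by (rule radial_poly_root_eigenvalue)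
  then have V1: "lambda_1 (half_line l) ?V \<le> 1 - \<rho>"
    unfolding lambda_1_def using finV by (intro Min_le)
  have "1 - (- \<rho>) \<in> ?EV"
    using assms(6) by (rule radial_poly_root_eigenvalue) (simp only: radial_poly_uminus root mult_zero_right)
  then have Vmax: "1 + \<rho> \<le> lambda_max (half_line l) ?V"
    unfolding lambda_max_def using finV by (intro Max_ge) simp_all
  have B: "?B \<subseteq> verts G" by (auto simp: graph_ball_def)
  have degB: "0 < wdegree G x" if "x \<in> ?B" for x
    using wdegree_pos_infinite[OF assms(2)] that B by auto
  have "x0 \<in> ?B" using assms(3) graph_dist_eq_0[of x0 x0] by (simp add: graph_ball_def)
  then have EB: "finite ?EB" "?EB \<noteq> {}"
    using dirichlet_eigenvalues_finite_nonempty[OF finite_graph_ball[OF assms(3)] _ _ degB]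
      weight_sym B by (metis (no_types, lifting) emptyE subsetD)+
  have "\<bar>1 - c\<bar> \<le> \<rho> + kappa G x0 r" if "c \<in> ?EB" for c
  proof (rule positive_supersolution_eigenvalue_bound[OF finite_graph_ball[OF assms(3)] _ _ _ _ that])
    fix x assume x: "x \<in> ?B"
    show "0 < radial_poly l (graph_dist G x0 x) \<rho>" using x by (intro pos) (simp add: graph_ball_def)
    have "l * mu_minus G x0 x \<le> wdegree G x" if "x \<noteq> x0"
      unfolding assms(5) using x that by (intro INF_mult_mu_minus_le) simp
    then show "(\<Sum>y\<in>?B. weight G x y * radial_poly l (graph_dist G x0 y) \<rho>)
        \<le> (\<rho> + kappa G x0 r) * wdegree G x * radial_poly l (graph_dist G x0 x) \<rho>"
      using transplanted_supersolution[OF assms(3) x assms(6) \<rho> root pos]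
        mu_zero_le_kappa[OF assms(3) x degB[OF x]] by blast
  qed (use degB weight_nonneg B in auto)
  then have bound: "1 - \<rho> - kappa G x0 r \<le> c \<and> c \<le> 1 + \<rho> + kappa G x0 r" if "c \<in> ?EB" for c
    using that by (force simp: abs_le_iff)
  have "1 - \<rho> - kappa G x0 r \<le> lambda_1 G ?B"
    unfolding lambda_1_def using bound EB by simp
  moreover have "lambda_max G ?B \<le> 1 + \<rho> + kappa G x0 r"
    unfolding lambda_max_def using bound EB by simp
  ultimately show ?thesis
    using V1 Vmax unfolding graph_ball_half_line by linarith
qed

end
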